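(* Let $H$ be a real Hilbert space, $a:H\times H\to\mathbb{R}$ a continuous bilinear form, $\ell:H\to\mathbb{R}$ a continuous linear form, and let $u\in H$ be a solution of $a(u,v)=\ell(v)$ for all $v\in H$. Let $X_h$, $Y_h$ be real normed vector spaces, $a_h:X_h\times Y_h\to\mathbb{R}$ a bilinear form and $\ell_h:Y_h\to\mathbb{R}$ a linear form. Assume that $a_h$ is inf--sup stable for $(\|\cdot\|_{X_h},\|\cdot\|_{Y_h})$ with constant $\gamma>0$. Let $I_hu\in X_h$ be given and let $\mathcal{E}_h(u;\cdot):Y_h\to\mathbb{R}$ be the variational consistency error $\mathcal{E}_h(u;\cdot)=\ell_h(\cdot)-a_h(I_hu,\cdot)$. If $u_h\in X_h$ is a solution of $$a_h(u_h,v_h)=\ell_h(v_h)\quad\forall v_h\in Y_h,$$ then $$\|u_h-I_hu\|_{X_h}\le\gamma^{-1}\|\mathcal{E}_h(u;\cdot)\|_{Y_h^\star}.$$ As a consequence, let a family $(X_h,a_h,\ell_h)_{h\to0}$ of spaces and forms be given (with associated $Y_h$, elements $I_hu\in X_h$ and discrete solutions $u_h$). If consistency holds, i.e. $\|\mathcal{E}_h(u;\cdot)\|_{Y_h^\star}\to0$ as $h\to0$, and $\gamma$ does not depend on $h$, then convergence holds in the sense that $\|u_h-I_hu\|_{X_h}\to0$ as $h\to0$.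
   Context: The spaces $X_h$ and $Y_h$ are not assumed to be spaces of functions, nor embedded in a space containing $H$; no property of the element $I_hu\in X_h$ is required. The index $h$ is a discretisation parameter. The bilinear form $a_h$ is inf--sup stable for $(\|\cdot\|_{X_h},\|\cdot\|_{Y_h})$ with constant $\gamma>0$ if $$\gamma\|w_h\|_{X_h}\le\sup_{v_h\in Y_h\setminus\{0\}}\frac{a_h(w_h,v_h)}{\|v_h\|_{Y_h}}\quad\forall w_h\in X_h.$$ For a linear form $\mu:Z\to\mathbb{R}$ on a normed space $Z$, $\|\mu\|_{Z^\star}=\sup_{z\in Z\setminus\{0\}}\frac{|\mu(z)|}{\|z\|_Z}\in[0,+\infty]$. *)

theory Defs
  imports "HOL-Analysis.Analysis" "HOL-Algebra.Module" "HOL-Algebra.Algebraic_Closure_Type"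
begin

(* Carrier-based normed spaces are used for the discrete spaces because a family indexed by h
   may change its space with h, which a type cannot.  The fields mult and one that a module
   record inherits are unused. *)

abbreviation real_field :: "real ring" where
  "real_field \<equiv> ring_of_type_algebra"

record 'v normed_module = "(real, 'v) module" +
  vnorm :: "'v \<Rightarrow> real"

locale real_normed_space = module real_field V for V :: "('v, 'm) normed_module_scheme" (structure) +
  assumes vnorm_eq_0_iff: "x \<in> carrier V \<Longrightarrow> vnorm V x = 0 \<longleftrightarrow> x = \<zero>"
    and vnorm_triangle: "x \<in> carrier V \<Longrightarrow> y \<in> carrier V \<Longrightarrow> vnorm V (x \<oplus> y) \<le> vnorm V x + vnorm V y"
    and vnorm_smult: "x \<in> carrier V \<Longrightarrow> vnorm V (c \<odot> x) = \<bar>c\<bar> * vnorm V x"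

definition linear_form_on :: "('v, 'm) normed_module_scheme \<Rightarrow> ('v \<Rightarrow> real) \<Rightarrow> bool" where
  "linear_form_on V f \<longleftrightarrow>
     (\<forall>x\<in>carrier V. \<forall>y\<in>carrier V. f (x \<oplus>\<^bsub>V\<^esub> y) = f x + f y) \<and>
     (\<forall>c. \<forall>x\<in>carrier V. f (c \<odot>\<^bsub>V\<^esub> x) = c * f x)"

definition bilinear_form_on ::
    "('v, 'm) normed_module_scheme \<Rightarrow> ('w, 'n) normed_module_scheme \<Rightarrow> ('v \<Rightarrow> 'w \<Rightarrow> real) \<Rightarrow> bool" where
  "bilinear_form_on V W b \<longleftrightarrow>
     (\<forall>x\<in>carrier V. linear_form_on W (\<lambda>y. b x y)) \<and>
     (\<forall>y\<in>carrier W. linear_form_on V (\<lambda>x. b x y))"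

(* The supremum is taken in [0, \<infinity>]; it is 0 when the space is trivial. *)
definition dual_norm :: "('v, 'm) normed_module_scheme \<Rightarrow> ('v \<Rightarrow> real) \<Rightarrow> ennreal" where
  "dual_norm V f = (SUP z\<in>carrier V - {\<zero>\<^bsub>V\<^esub>}. ennreal (\<bar>f z\<bar> / vnorm V z))"

(* The maximum with 0 only matters for the trivial test space, where the supremum over the
   empty set is then 0 rather than -\<infinity>, as in dual_norm.  For a nontrivial test space the
   supremum is nonnegative, because v can be replaced by -v. *)
definition inf_sup_stable ::
    "('v, 'm) normed_module_scheme \<Rightarrow> ('w, 'n) normed_module_scheme \<Rightarrow> ('v \<Rightarrow> 'w \<Rightarrow> real) \<Rightarrow> real \<Rightarrow> bool" where
  "inf_sup_stable Xh Yh b \<gamma> \<longleftrightarrow>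
     (\<forall>w\<in>carrier Xh. ereal (\<gamma> * vnorm Xh w) \<le>
        max 0 (SUP v\<in>carrier Yh - {\<zero>\<^bsub>Yh\<^esub>}. ereal (b w v / vnorm Yh v)))"

definition consistency_error ::
    "('x \<Rightarrow> 'y \<Rightarrow> real) \<Rightarrow> ('y \<Rightarrow> real) \<Rightarrow> 'x \<Rightarrow> 'y \<Rightarrow> real" where
  "consistency_error ah lh Ihu = (\<lambda>v. lh v - ah Ihu v)"

end

theory Submission
  imports Defs
begin

text \<open>Let \<open>e\<close> be the difference of \<open>uh\<close> and \<open>Ihu\<close>.
  Linearity of \<open>ah\<close> in its first argument and the discrete equation turn the
  consistency error into \<open>ah e v\<close>. Inf-sup stability at \<open>e\<close> therefore
  bounds \<gamma> times the norm of \<open>e\<close> by the supremum that defines the dual norm of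
  this error; dividing by \<gamma> gives \<open>discrete_error_le_dual_norm\<close>. For a family
  with one common \<gamma>, the bound holds at every \<open>h\<close> with the same factor, so
  convergence follows by squeezing.\<close>

lemma (in real_normed_space) vnorm_nonneg:
  assumes x: "x \<in> carrier V"
  shows "0 \<le> vnorm V x"
proof -
  \<comment> \<open>Nonnegativity is not an axiom of the locale. It comes from the triangle
    inequality for \<open>-x\<close> and \<open>x\<close>, whose sum has norm 0 and whose norms
    agree by homogeneity.\<close>
  have "(-1) \<odot> x \<oplus> 1 \<odot> x = (-1 + 1) \<odot> x"
    using smult_l_distr[of "-1" 1 x] x by (simp add: ring_of_type_algebra_def)
  also have "\<dots> = \<zero>"
    using smult_l_null[OF x] by (simp add: ring_of_type_algebra_def)
  finally have "0 = vnorm V ((-1) \<odot> x \<oplus> 1 \<odot> x)"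
    using vnorm_eq_0_iff[of \<zero>] by simp
  also have "\<dots> \<le> vnorm V ((-1) \<odot> x) + vnorm V (1 \<odot> x)"
    using x by (intro vnorm_triangle smult_closed) (simp_all add: ring_of_type_algebra_def)
  also have "\<dots> = 2 * vnorm V x"
    using x by (simp add: vnorm_smult)
  finally show ?thesis by simp
qed

lemma (in real_normed_space) linear_form_on_diff:
  assumes f: "linear_form_on V f" and x: "x \<in> carrier V" and y: "y \<in> carrier V"
  shows "f (x \<ominus> y) = f x - f y"
proof -
  \<comment> \<open>Adding \<open>f y\<close> back needs only additivity of \<open>f\<close>, so the
    group inverse behind \<open>\<ominus>\<close> need not be identified with multiplication by
    -1.\<close>
  have "f (x \<ominus> y) + f y = f ((x \<ominus> y) \<oplus> y)"
    using f x y by (simp add: linear_form_on_def)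
  also have "(x \<ominus> y) \<oplus> y = x"
    using x y by (simp add: minus_eq a_assoc l_neg)
  finally show ?thesis by simp
qed

text \<open>Stability is tested at the error itself, where the form equals the residual of
  \<open>Ihu\<close>. Working in \<open>ennreal\<close> lets an infinite dual norm be treated like a
  finite one.\<close>

lemma discrete_error_le_dual_norm:
  assumes X: "real_normed_space Xh" and Y: "real_normed_space Yh"
    and b: "bilinear_form_on Xh Yh ah" and \<gamma>: "\<gamma> > 0" and stab: "inf_sup_stable Xh Yh ah \<gamma>"
    and I: "Ihu \<in> carrier Xh" and uh: "uh \<in> carrier Xh"
    and sol: "\<forall>v\<in>carrier Yh. ah uh v = lh v"
  shows "ennreal (vnorm Xh (uh \<ominus>\<^bsub>Xh\<^esub> Ihu))
    \<le> ennreal (inverse \<gamma>) * dual_norm Yh (consistency_error ah lh Ihu)"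
proof -
  interpret X: real_normed_space Xh by (rule X)
  interpret Y: real_normed_space Yh by (rule Y)
  define e where "e = uh \<ominus>\<^bsub>Xh\<^esub> Ihu"
  define E where "E = consistency_error ah lh Ihu"
  have e: "e \<in> carrier Xh"
    unfolding e_def using I uh by simp
  have residual: "ah e v = E v" if "v \<in> carrier Yh" for v
    using X.linear_form_on_diff[of "\<lambda>x. ah x v" uh Ihu] b I uh sol that
    by (simp add: e_def E_def consistency_error_def bilinear_form_on_def)
  have "ereal (\<gamma> * vnorm Xh e)
      \<le> max 0 (SUP v\<in>carrier Yh - {\<zero>\<^bsub>Yh\<^esub>}. ereal (ah e v / vnorm Yh v))"
    using stab e by (simp add: inf_sup_stable_def)
  \<comment> \<open>The stability supremum has signed quotients in \<open>ereal\<close>, the dual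
    norm absolute values in \<open>ennreal\<close>; passing to absolute values only enlarges each
    quotient. The bound for the 0 in \<open>max\<close> is nonnegativity of
    \<open>enn2ereal\<close>, which also settles a trivial test space.\<close>
  also have "\<dots> \<le> enn2ereal (dual_norm Yh E)"
  proof (intro max.boundedI SUP_least)
    fix v assume v: "v \<in> carrier Yh - {\<zero>\<^bsub>Yh\<^esub>}"
    have nonneg: "0 \<le> vnorm Yh v"
      using v Y.vnorm_nonneg by simp
    have "ereal (ah e v / vnorm Yh v) \<le> ereal (\<bar>E v\<bar> / vnorm Yh v)"
      using v nonneg residual by (simp add: divide_right_mono)
    also have "\<dots> = enn2ereal (ennreal (\<bar>E v\<bar> / vnorm Yh v))"
      using nonneg by simp
    also have "\<dots> \<le> enn2ereal (dual_norm Yh E)"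
      unfolding dual_norm_def less_eq_ennreal.rep_eq[symmetric] using v by (rule SUP_upper)
    finally show "ereal (ah e v / vnorm Yh v) \<le> enn2ereal (dual_norm Yh E)" .
  qed simp
  finally have "ennreal (\<gamma> * vnorm Xh e) \<le> dual_norm Yh E"
    using \<gamma> X.vnorm_nonneg[OF e] by (simp add: less_eq_ennreal.rep_eq)
  then have "ennreal (inverse \<gamma>) * ennreal (\<gamma> * vnorm Xh e) \<le> ennreal (inverse \<gamma>) * dual_norm Yh E"
    by (rule mult_left_mono) simp
  then show ?thesis
    using \<gamma> by (simp add: e_def E_def ennreal_mult'[symmetric] mult.assoc[symmetric])
qed

theorem theorem10:
  fixes a :: "'H::{real_inner, complete_space} \<Rightarrow> 'H \<Rightarrow> real"
    and l :: "'H \<Rightarrow> real" and u :: 'H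
  assumes "bounded_bilinear a" and "bounded_linear l"
    and "\<forall>v. a u v = l v"
  shows
    "(\<forall>(Xh :: 'x normed_module) (Yh :: 'y normed_module) ah lh \<gamma> Ihu uh.
        real_normed_space Xh \<and> real_normed_space Yh \<and>
        bilinear_form_on Xh Yh ah \<and> linear_form_on Yh lh \<and>
        \<gamma> > 0 \<and> inf_sup_stable Xh Yh ah \<gamma> \<and>
        Ihu \<in> carrier Xh \<and> uh \<in> carrier Xh \<and>
        (\<forall>v\<in>carrier Yh. ah uh v = lh v)
        \<longrightarrow> ennreal (vnorm Xh (uh \<ominus>\<^bsub>Xh\<^esub> Ihu))
              \<le> ennreal (inverse \<gamma>) * dual_norm Yh (consistency_error ah lh Ihu))
   \<and> (\<forall>(HH :: real set) (Xh :: real \<Rightarrow> 'x normed_module) (Yh :: real \<Rightarrow> 'y normed_module)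
         ah lh \<gamma> Ihu uh.
        HH \<subseteq> {0<..} \<and> \<gamma> > 0 \<and>
        (\<forall>h\<in>HH.
           real_normed_space (Xh h) \<and> real_normed_space (Yh h) \<and>
           bilinear_form_on (Xh h) (Yh h) (ah h) \<and> linear_form_on (Yh h) (lh h) \<and>
           inf_sup_stable (Xh h) (Yh h) (ah h) \<gamma> \<and>
           Ihu h \<in> carrier (Xh h) \<and> uh h \<in> carrier (Xh h) \<and>
           (\<forall>v\<in>carrier (Yh h). ah h (uh h) v = lh h v)) \<and>
        ((\<lambda>h. dual_norm (Yh h) (consistency_error (ah h) (lh h) (Ihu h))) \<longlongrightarrow> 0)
          (at 0 within HH)
        \<longrightarrow> ((\<lambda>h. vnorm (Xh h) (uh h \<ominus>\<^bsub>Xh h\<^esub> Ihu h)) \<longlongrightarrow> 0) (at 0 within HH))"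
proof (intro conjI allI impI)
  fix Xh :: "'x normed_module" and Yh :: "'y normed_module" and ah lh \<gamma> Ihu uh
  assume "real_normed_space Xh \<and> real_normed_space Yh \<and>
        bilinear_form_on Xh Yh ah \<and> linear_form_on Yh lh \<and>
        \<gamma> > 0 \<and> inf_sup_stable Xh Yh ah \<gamma> \<and>
        Ihu \<in> carrier Xh \<and> uh \<in> carrier Xh \<and>
        (\<forall>v\<in>carrier Yh. ah uh v = lh v)"
  then show "ennreal (vnorm Xh (uh \<ominus>\<^bsub>Xh\<^esub> Ihu))
      \<le> ennreal (inverse \<gamma>) * dual_norm Yh (consistency_error ah lh Ihu)"
    by (elim conjE) (rule discrete_error_le_dual_norm)
next
  fix HH :: "real set" and Xh :: "real \<Rightarrow> 'x normed_module" and Yh :: "real \<Rightarrow> 'y normed_module"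
    and ah lh \<gamma> Ihu uh
  assume asm: "HH \<subseteq> {0<..} \<and> \<gamma> > 0 \<and>
        (\<forall>h\<in>HH.
           real_normed_space (Xh h) \<and> real_normed_space (Yh h) \<and>
           bilinear_form_on (Xh h) (Yh h) (ah h) \<and> linear_form_on (Yh h) (lh h) \<and>
           inf_sup_stable (Xh h) (Yh h) (ah h) \<gamma> \<and>
           Ihu h \<in> carrier (Xh h) \<and> uh h \<in> carrier (Xh h) \<and>
           (\<forall>v\<in>carrier (Yh h). ah h (uh h) v = lh h v)) \<and>
        ((\<lambda>h. dual_norm (Yh h) (consistency_error (ah h) (lh h) (Ihu h))) \<longlongrightarrow> 0)
          (at 0 within HH)"
  let ?e = "\<lambda>h. vnorm (Xh h) (uh h \<ominus>\<^bsub>Xh h\<^esub> Ihu h)"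
  let ?E = "\<lambda>h. dual_norm (Yh h) (consistency_error (ah h) (lh h) (Ihu h))"
  have bound: "ennreal (?e h) \<le> ennreal (inverse \<gamma>) * ?E h" if "h \<in> HH" for h
    by (rule discrete_error_le_dual_norm) (use asm that in simp_all)
  have nonneg: "0 \<le> ?e h" if "h \<in> HH" for h
  proof -
    interpret real_normed_space "Xh h" using asm that by simp
    show ?thesis using asm that by (intro vnorm_nonneg) simp
  qed
  \<comment> \<open>Multiplication by a constant preserves limits in \<open>ennreal\<close> if the
    constant is finite; here it is also the same for all \<open>h\<close>.\<close>
  have "((\<lambda>h. ennreal (inverse \<gamma>) * ?E h) \<longlongrightarrow> ennreal (inverse \<gamma>) * 0) (at 0 within HH)"
    using asm by (intro ennreal_tendsto_cmult) simp_all
  then have lim: "((\<lambda>h. ennreal (inverse \<gamma>) * ?E h) \<longlongrightarrow> ennreal 0) (at 0 within HH)"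
    by simp
  \<comment> \<open>Squeezed between 0 and the stability bound. Estimates on \<open>HH\<close>
    suffice, as the filter is restricted to \<open>HH\<close>.\<close>
  have "((\<lambda>h. ennreal (?e h)) \<longlongrightarrow> ennreal 0) (at 0 within HH)"
    by (rule tendsto_sandwich[OF _ _ tendsto_const lim])
      (simp_all add: eventually_at_filter bound)
  \<comment> \<open>Since \<open>ennreal\<close> sends negative reals to 0, returning to real limits
    requires \<open>?e\<close> to be nonnegative on \<open>HH\<close>.\<close>
  then show "(?e \<longlongrightarrow> 0) (at 0 within HH)"
    by (rule tendsto_ennrealD) (simp_all add: eventually_at_filter nonneg)
qed

end
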